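(* Let $\eta\in(0,1)$ and $q\in(0,1)$. Then $\tau^\theta$ converges in distribution to the Kesten tree $\tau^0$ as $\theta\to0$ (with $\theta>0$).
   Context: Notation: $\mathbb{N}=\{0,1,2,\ldots\}$, $\mathbb{N}^*=\{1,2,\ldots\}$, $\bar{\mathbb{N}}=\mathbb{N}\cup\{+\infty\}$, $x\vee y=\max(x,y)$. Trees. Let $\mathcal{U}=\bigcup_{n\ge0}(\mathbb{N}^* )^n$ be the set of finite words, with $(\mathbb{N}^* )^0=\{\emptyset\}$; $|u|$ is the length of $u$. A tree is a subset $\mathbf{t}\subset\mathcal{U}$ containing $\emptyset$ (the root), containing with each $u$ all its prefixes (ancestors), and such that for every $u\in\mathbf{t}$ there is $k_u(\mathbf{t})\in\bar{\mathbb{N}}$ (the number of children of $u$) with $ui\in\mathbf{t}\iff 1\le i\le k_u(\mathbf{t})$ for every $i\in\mathbb{N}^*$. Put $k_u(\mathbf{t})=-1$ if $u\notin\mathbf{t}$. $\mathbb{T}_\infty$ is the set of all trees, with the topology in which $\mathbf{t}_n\to\mathbf{t}$ iff $k_u(\mathbf{t}_n)\to k_u(\mathbf{t})$ for all $u\in\mathcal{U}$, where $\{-1\}\cup\bar{\mathbb{N}}$ is the one-point compactification of the discrete space $\{-1\}\cup\mathbb{N}$. Convergence in distribution of random trees is weak convergence in $\mathbb{T}_\infty$. Put $r_h(\mathbf{t})=\{u\in\mathbf{t}:|u|\le h\}$. Offspring distribution. $\mathcal{G}(\eta,q)$ is the distribution $p$ on $\mathbb{N}$ with $p(0)=1-\eta$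 and $p(k)=\eta q(1-q)^{k-1}$ for $k\ge1$. Its mean is $\mu=\eta/q$. Put $\gamma=\frac1{1-q}$, $\kappa=\frac{1-\eta}{1-q}$, $\mathfrak{c}=\min(1,\kappa)>0$, and $\mathfrak{p}(n)=\mathfrak{c}^{n-1}p(n)$ for $n\in\mathbb{N}$ (a probability distribution: $\mathfrak{p}=p$ if $\mu\le1$ and $\mathfrak{p}=\mathcal{G}(q,\eta)$ if $\mu>1$). For $s\ge1$ its $s$-th order size-biased distribution $\mathfrak{p}_{[s]}$ is the probability distribution proportional to $\frac{n!}{(n-s)!}\mathfrak{p}(n)$, $n\ge s$; explicitly $\mathfrak{p}_{[s]}(n)=\binom{n}{s}(q\vee\eta)^{s+1}(1-(q\vee\eta))^{n-s}$. Kesten tree $\tau^0$. Consider the two-type Galton-Watson tree, with types $\mathrm{s}$ and $\mathrm{e}$, such that: conditionally on the vertices of lower or same height, the offspring of a vertex depends only on its own type (branching property); the root has type $\mathrm{s}$; a vertex of type $\mathrm{e}$ has only children of type $\mathrm{e}$, their number having distribution $\mathfrak{p}$; a vertex of type $\mathrm{s}$ has a number of children with distribution $\mathfrak{p}_{[1]}$, all of type $\mathrm{e}$ except one, chosen uniformly at random, of type $\mathrm{s}$. Then $\tau^0$ is this random tree with the types forgotten. The random tree $\tau^\theta$, $\theta\in(0,+\infty)$. It is obtained by forgetting the types in a random tree whose vertices have type $\mathrm{s}$ or $\mathrm{e}$, where $\mathcal{S}_h$ denotes the set of vertices of type $\mathrm{s}$ at level $h$, defined generation by generation as follows. (i) The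 root has type $\mathrm{s}$: $\mathcal{S}_0=\{\emptyset\}$. (ii) The vertices of type $\mathrm{e}$ reproduce independently of each other and of everything else at lower or same height; a vertex of type $\mathrm{e}$ has only children of type $\mathrm{e}$, their number having distribution $\mathfrak{p}$. (iii) For $h\ge0$, conditionally on $r_h(\tau^\theta)$ and $(\mathcal{S}_\ell,0\le\ell\le h)$, the increment $\Delta_h=\#\mathcal{S}_{h+1}-\#\mathcal{S}_h$ is Poisson with mean $\theta\zeta_h$, where $$\zeta_h=\begin{cases}\mu^{-h-1}(1-\mu)(\kappa-1)/\kappa&\text{if }\mu<1,\\ \gamma-1&\text{if }\mu=1,\\ \mu^h(\mu-1)(1-\kappa)&\text{if }\mu>1.\end{cases}$$ Each $u\in\mathcal{S}_h$ has $\kappa^{\mathrm{s}}(u)\ge1$ children of type $\mathrm{s}$; given $\#\mathcal{S}_{h+1}$, all configurations $(\kappa^{\mathrm{s}}(u),u\in\mathcal{S}_h)$ of integers $\ge1$ with sum $\#\mathcal{S}_{h+1}$ are equally likely, each having probability $1/\binom{\#\mathcal{S}_{h+1}-1}{\#\mathcal{S}_h-1}$. Conditionally on $r_h(\tau^\theta)$, $\mathcal{S}_h$ and $(\kappa^{\mathrm{s}}(v)=s_v,v\in\mathcal{S}_h)$, independently for each $u\in\mathcal{S}_h$, the total number of children $k_u(\tau^\theta)$ has distribution $\mathfrak{p}_{[s_u]}$, and the $s_u$ children of type $\mathrm{s}$ are chosen uniformly at random among the $k_u(\tau^\theta)$ children, the others being of type $\mathrm{e}$. *)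

theory Defs
  imports "HOL-Probability.Probability"
begin

section \<open>The space of trees\<close>

text \<open>Words over the positive integers are lists of naturals not containing 0; the child
  \<open>ui\<close> of \<open>u\<close> is \<open>u @ [i]\<close>.\<close>

type_synonym word = "nat list"

definition words :: "word set" where
  "words = {u. 0 \<notin> set u}"

definition is_tree :: "word set \<Rightarrow> bool" where
  "is_tree t \<longleftrightarrow>
     t \<subseteq> words \<and> [] \<in> t \<and> (\<forall>u v. u @ v \<in> t \<longrightarrow> u \<in> t) \<and>
     (\<forall>u\<in>t. \<exists>k::enat. \<forall>i\<ge>1. u @ [i] \<in> t \<longleftrightarrow> enat i \<le> k)"

lemma is_tree_root: "is_tree {[]}"
  by (auto simp: is_tree_def words_def zero_enat_def intro!: exI[of _ 0])

typedef otree = "{t. is_tree t}"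
  using is_tree_root by blast

text \<open>The values lie in \<open>{-1} \<union> {0, 1, 2, \<dots>} \<union> {\<infinity>}\<close>. As a subspace of \<^typ>\<open>ereal\<close> this set
  is the one-point compactification of the discrete space \<open>{-1, 0, 1, \<dots>}\<close>.\<close>

definition num_children :: "otree \<Rightarrow> word \<Rightarrow> ereal" where
  "num_children t u =
     (if u \<in> Rep_otree t
      then ereal_of_enat (THE k. \<forall>i\<ge>1. u @ [i] \<in> Rep_otree t \<longleftrightarrow> enat i \<le> k)
      else -1)"

text \<open>The topology on trees is the one induced by \<^const>\<open>num_children\<close> from the product topology,
  i.e. the topology of pointwise convergence of the numbers of children. A word that is not in
  \<^const>\<open>words\<close> contributes the constant \<open>-1\<close> and has no influence on it.\<close>

instantiation otree :: topological_space
begin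

definition open_otree :: "otree set \<Rightarrow> bool" where
  "open_otree U \<longleftrightarrow> (\<exists>W. open W \<and> U = num_children -` W)"

instance
proof
  show "open (UNIV :: otree set)"
    unfolding open_otree_def by (intro exI[of _ UNIV]) auto
next
  fix S T :: "otree set"
  assume "open S" "open T"
  then obtain V W where "open V" "S = num_children -` V" "open W" "T = num_children -` W"
    unfolding open_otree_def by auto
  then show "open (S \<inter> T)"
    unfolding open_otree_def by (intro exI[of _ "V \<inter> W"]) auto
next
  fix K :: "otree set set"
  assume "\<forall>S\<in>K. open S"
  then have "\<forall>S\<in>K. \<exists>W. open W \<and> S = num_children -` W"
    unfolding open_otree_def by simp
  then obtain W where W: "\<And>S. S \<in> K \<Longrightarrow> open (W S) \<and> S = num_children -` W S"
    by metis
  have "\<Union>K = num_children -` (\<Union>S\<in>K. W S)"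
    using W by blast
  then show "open (\<Union>K)"
    unfolding open_otree_def using W by (intro exI[of _ "\<Union>S\<in>K. W S"]) auto
qed

end

section \<open>Weak convergence\<close>

definition weakly_converges ::
    "('i \<Rightarrow> 'a::topological_space measure) \<Rightarrow> 'a measure \<Rightarrow> 'i filter \<Rightarrow> bool" where
  "weakly_converges N N0 F \<longleftrightarrow>
     (\<forall>f :: 'a \<Rightarrow> real. continuous_on UNIV f \<longrightarrow> bounded (range f) \<longrightarrow>
        ((\<lambda>i. integral\<^sup>L (N i) f) \<longlongrightarrow> integral\<^sup>L N0 f) F)"

section \<open>Offspring distributions\<close>

definition offspring :: "real \<Rightarrow> real \<Rightarrow> nat \<Rightarrow> real" where
  "offspring \<eta> q k = (if k = 0 then 1 - \<eta> else \<eta> * q * (1 - q) ^ (k - 1))"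

definition mu :: "real \<Rightarrow> real \<Rightarrow> real" where
  "mu \<eta> q = \<eta> / q"

definition gam :: "real \<Rightarrow> real" where
  "gam q = 1 / (1 - q)"

definition kap :: "real \<Rightarrow> real \<Rightarrow> real" where
  "kap \<eta> q = (1 - \<eta>) / (1 - q)"

definition frakc :: "real \<Rightarrow> real \<Rightarrow> real" where
  "frakc \<eta> q = min 1 (kap \<eta> q)"

definition frakp :: "real \<Rightarrow> real \<Rightarrow> nat \<Rightarrow> real" where
  "frakp \<eta> q n = frakc \<eta> q powi (int n - 1) * offspring \<eta> q n"

definition frakp_pmf :: "real \<Rightarrow> real \<Rightarrow> nat pmf" where
  "frakp_pmf \<eta> q = embed_pmf (frakp \<eta> q)"

definition size_biased_weight :: "real \<Rightarrow> real \<Rightarrow> nat \<Rightarrow> nat \<Rightarrow> real" where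
  "size_biased_weight \<eta> q s n =
     (if n \<ge> s then fact n / fact (n - s) * frakp \<eta> q n else 0)"

definition size_biased_pmf :: "real \<Rightarrow> real \<Rightarrow> nat \<Rightarrow> nat pmf" where
  "size_biased_pmf \<eta> q s =
     embed_pmf (\<lambda>n. size_biased_weight \<eta> q s n / (\<Sum>m. size_biased_weight \<eta> q s m))"

definition zeta :: "real \<Rightarrow> real \<Rightarrow> nat \<Rightarrow> real" where
  "zeta \<eta> q h =
     (if mu \<eta> q < 1 then mu \<eta> q powi (- int h - 1) * (1 - mu \<eta> q) * (kap \<eta> q - 1) / kap \<eta> q
      else if mu \<eta> q = 1 then gam q - 1
      else mu \<eta> q ^ h * (mu \<eta> q - 1) * (1 - kap \<eta> q))"

section \<open>Generations of two-type trees\<close>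

text \<open>A generation is a pair \<open>(V, S)\<close>: the vertices at a given level and, among them, those of
  type s. The reproduction of a vertex is a pair \<open>(n, I)\<close>: its number of children and the set of
  those \<open>i\<close> in \<open>{1..n}\<close> for which the \<open>i\<close>-th child has type s.\<close>

type_synonym generation = "word set \<times> word set"

definition next_generation :: "word set \<Rightarrow> (word \<Rightarrow> nat \<times> nat set) \<Rightarrow> generation" where
  "next_generation V c =
     ({u @ [i] | u i. u \<in> V \<and> i \<in> {1..fst (c u)}}, {u @ [i] | u i. u \<in> V \<and> i \<in> snd (c u)})"

definition reproduction_e :: "real \<Rightarrow> real \<Rightarrow> (nat \<times> nat set) pmf" where
  "reproduction_e \<eta> q = map_pmf (\<lambda>n. (n, {})) (frakp_pmf \<eta> q)"

definition kesten_reproduction_s :: "real \<Rightarrow> real \<Rightarrow> (nat \<times> nat set) pmf" where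
  "kesten_reproduction_s \<eta> q =
     do { n \<leftarrow> size_biased_pmf \<eta> q 1;
          i \<leftarrow> pmf_of_set {1..n};
          return_pmf (n, {i}) }"

definition kesten_step :: "real \<Rightarrow> real \<Rightarrow> generation \<Rightarrow> generation pmf" where
  "kesten_step \<eta> q = (\<lambda>(V, S).
     do { c \<leftarrow> Pi_pmf V (0, {})
                 (\<lambda>u. if u \<in> S then kesten_reproduction_s \<eta> q else reproduction_e \<eta> q);
          return_pmf (next_generation V c) })"

text \<open>Here \<open>s\<close> is the prescribed number of children of type s.\<close>

definition reproduction_s :: "real \<Rightarrow> real \<Rightarrow> nat \<Rightarrow> (nat \<times> nat set) pmf" where
  "reproduction_s \<eta> q s =
     do { n \<leftarrow> size_biased_pmf \<eta> q s;
          I \<leftarrow> pmf_of_set {I. I \<subseteq> {1..n} \<and> card I = s};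
          return_pmf (n, I) }"

definition configurations :: "word set \<Rightarrow> nat \<Rightarrow> (word \<Rightarrow> nat) set" where
  "configurations S m = {k \<in> S \<rightarrow>\<^sub>E {1..}. (\<Sum>u\<in>S. k u) = m}"

definition tau_step :: "real \<Rightarrow> real \<Rightarrow> real \<Rightarrow> nat \<Rightarrow> generation \<Rightarrow> generation pmf" where
  "tau_step \<eta> q \<theta> h = (\<lambda>(V, S).
     do { \<Delta> \<leftarrow> poisson_pmf (\<theta> * zeta \<eta> q h);
          k \<leftarrow> pmf_of_set (configurations S (card S + \<Delta>));
          c \<leftarrow> Pi_pmf V (0, {})
                 (\<lambda>u. if u \<in> S then reproduction_s \<eta> q (k u) else reproduction_e \<eta> q);
          return_pmf (next_generation V c) })"

section \<open>The random trees\<close>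

text \<open>The law of the time-inhomogeneous Markov chain that starts in \<open>x0\<close> and moves from
  time \<open>h\<close> to time \<open>h + 1\<close> according to \<open>K h\<close>, as the projective limit given by the
  Ionescu-Tulcea theorem.\<close>

definition chain_kernel :: "'a \<Rightarrow> (nat \<Rightarrow> 'a \<Rightarrow> 'a pmf) \<Rightarrow> nat \<Rightarrow> (nat \<Rightarrow> 'a) \<Rightarrow> 'a measure" where
  "chain_kernel x0 K n \<omega> =
     measure_pmf (case n of 0 \<Rightarrow> return_pmf x0 | Suc h \<Rightarrow> K h (\<omega> h))"

lemma Ionescu_Tulcea_chain_kernel:
  "Ionescu_Tulcea (chain_kernel x0 K) (\<lambda>_. count_space UNIV)"
proof (rule Ionescu_Tulcea.intro)
  fix i :: nat
  show "chain_kernel x0 K i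
          \<in> measurable (PiM {0..<i} (\<lambda>_. count_space UNIV)) (subprob_algebra (count_space UNIV))"
  proof (cases i)
    case 0
    then show ?thesis
      by (auto simp: chain_kernel_def[abs_def] measure_pmf_in_subprob_algebra
               intro!: measurable_const)
  next
    case (Suc h)
    have "(\<lambda>\<omega>. measure_pmf (K h (\<omega> h)))
            \<in> measurable (PiM {0..<Suc h} (\<lambda>_. count_space UNIV))
                          (subprob_algebra (count_space UNIV))"
      by (rule measurable_compose[OF measurable_component_singleton])
         (auto simp: measure_pmf_in_subprob_algebra)
    then show ?thesis
      by (simp add: Suc chain_kernel_def[abs_def])
  qed
next
  fix i :: nat and \<omega>
  show "prob_space (chain_kernel x0 K i \<omega>)"
    unfolding chain_kernel_def by (rule prob_space_measure_pmf)
qed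

definition chain_law :: "'a \<Rightarrow> (nat \<Rightarrow> 'a \<Rightarrow> 'a pmf) \<Rightarrow> (nat \<Rightarrow> 'a) measure" where
  "chain_law x0 K =
     projective_family.lim UNIV
       (Ionescu_Tulcea.CI (chain_kernel x0 K) (\<lambda>_. count_space UNIV)) (\<lambda>_. count_space UNIV)"

text \<open>Forgetting the types keeps only the first components. The sample paths for which
  their union is not a tree form a null event, on which the value is irrelevant.\<close>

definition forget_types :: "(nat \<Rightarrow> generation) \<Rightarrow> otree" where
  "forget_types \<omega> =
     (let t = (\<Union>h. fst (\<omega> h)) in if is_tree t then Abs_otree t else Abs_otree {[]})"

definition kesten_law :: "real \<Rightarrow> real \<Rightarrow> otree measure" where
  "kesten_law \<eta> q =
     distr (chain_law ({[]}, {[]}) (\<lambda>_. kesten_step \<eta> q)) borel forget_types"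

definition tau_law :: "real \<Rightarrow> real \<Rightarrow> real \<Rightarrow> otree measure" where
  "tau_law \<eta> q \<theta> =
     distr (chain_law ({[]}, {[]}) (tau_step \<eta> q \<theta>)) borel forget_types"

end

theory Submission
  imports Defs
begin

text \<open>
  Why the theorem is true. In the construction of \<open>\<tau>\<^sup>\<theta>\<close>, the event that level \<open>h\<close> produces no additional
  vertex of type s has probability \<open>exp (- \<theta> \<zeta>\<^sub>h)\<close>, which tends to 1 as \<open>\<theta> \<rightarrow> 0\<close>. On this event, a
  generation with exactly one vertex of type s is turned into the next one exactly as in the Kesten
  tree. Hence one step of the chain with parameter \<open>\<theta>\<close> is bounded below, as a measure, by
  \<open>exp (- \<theta> \<zeta>\<^sub>h)\<close> times one step of the Kesten chain (\<open>tau_step_dominates_kesten_step\<close>), and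
  multiplying these bounds gives a lower bound for the law of the first \<open>n\<close> generations whose
  constant tends to 1 for each fixed \<open>n\<close> (\<open>path_pmf_domination\<close>).

  This lower bound suffices for weak convergence. The number of children of \<open>u\<close>
  is determined by the first \<open>|u| + 2\<close> generations, so a continuous function of the tree,
  seen as a function \<open>\<Phi>\<close> of the genealogy (the sequence of generations), satisfies: if \<open>\<Phi> \<omega> > a\<close>, then \<open>\<Phi> > a\<close> at
  all genealogies that agree with \<open>\<omega>\<close> up to some \<open>n\<close> (\<open>forget_types_continuous\<close>). For \<open>\<Phi> \<ge> 0\<close>
  let \<open>G\<^sub>n\<close> be the infimum of \<open>\<Phi>\<close> given the first \<open>n + 1\<close> generations. Then \<open>G\<^sub>n \<le> \<Phi> \<le> liminf G\<^sub>n\<close>, and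
  Fatou's lemma for the Kesten chain together with the lower bound for the law of \<open>n + 1\<close>
  generations shows that the lower limit of the expectations of \<open>\<Phi>\<close> is at least its expectation for the
  Kesten chain (\<open>chain_law_lower_semicontinuous\<close>). For a bounded continuous \<open>f\<close> this is applied to
  \<open>f + B\<close> and to \<open>- f + B\<close>, which gives both halves of the convergence.
\<close>

section \<open>Finite-dimensional laws of a Markov chain\<close>

abbreviation paths :: "nat set \<Rightarrow> (nat \<Rightarrow> 'a) measure" where
  "paths I \<equiv> PiM I (\<lambda>_. count_space UNIV)"

text \<open>The law of the first \<open>n\<close> states, on functions with the value \<open>undefined\<close> outside \<open>{0..<n}\<close>, which are
  the points of the product space over \<open>{0..<n}\<close>. As a pmf it integrates every function, whereas the
  product sigma-algebra over an uncountable state space does not contain all sets.\<close>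

primrec path_pmf :: "'a \<Rightarrow> (nat \<Rightarrow> 'a \<Rightarrow> 'a pmf) \<Rightarrow> nat \<Rightarrow> (nat \<Rightarrow> 'a) pmf" where
  "path_pmf x0 K 0 = return_pmf (\<lambda>_. undefined)"
| "path_pmf x0 K (Suc n) =
     bind_pmf (path_pmf x0 K n)
       (\<lambda>p. map_pmf (fun_upd p n) (case n of 0 \<Rightarrow> return_pmf x0 | Suc h \<Rightarrow> K h (p h)))"

lemma path_pmf_extensional:
  "p \<in> set_pmf (path_pmf x0 K n) \<Longrightarrow> p \<in> extensional {0..<n}"
proof (induction n arbitrary: p)
  case (Suc n)
  then obtain p' y where "p' \<in> extensional {0..<n}" "p = p'(n := y)"
    by auto
  then show ?case
    by (auto simp: extensional_def)
qed (simp add: extensional_def)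

lemma path_pmf_in_space:
  "p \<in> set_pmf (path_pmf x0 K n) \<Longrightarrow> p \<in> space (paths {0..<n})"
  using path_pmf_extensional[of p x0 K n] by (simp add: space_PiM PiE_def)

text \<open>A discrete law is carried by a countable set of paths. That set is measurable even when the
  state space is uncountable, and this makes any function on finite paths almost surely equal to a
  measurable one.\<close>

lemma countable_in_sets_paths:
  assumes "countable A" "A \<subseteq> space (paths {0..<n})"
  shows "A \<in> sets (paths {0..<n})"
proof (rule sets.countable[OF _ assms(1)])
  fix p assume "p \<in> A"
  then have "p \<in> extensional {0..<n}"
    using assms(2) by (auto simp: space_PiM PiE_def)
  then have "{p} = PiE {0..<n} (\<lambda>i. {p i})"
    by (simp add: PiE_singleton)
  also have "\<dots> \<in> sets (paths {0..<n})"
    by (intro sets_PiM_I_finite) auto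
  finally show "{p} \<in> sets (paths {0..<n})" .
qed

lemma measurable_countable_support:
  fixes G :: "(nat \<Rightarrow> 'a) \<Rightarrow> ennreal"
  assumes "countable A" "A \<subseteq> space (paths {0..<n})"
  shows "(\<lambda>p. if p \<in> A then G p else 0) \<in> borel_measurable (paths {0..<n})"
proof (rule measurableI)
  fix B :: "ennreal set"
  let ?M = "paths {0..<n} :: (nat \<Rightarrow> 'a) measure"
  have "(\<lambda>p. if p \<in> A then G p else 0) -` B \<inter> space ?M
      = {p\<in>A. G p \<in> B} \<union> (if 0 \<in> B then space ?M - A else {})"
    using assms(2) by (auto split: if_splits)
  moreover have "{p\<in>A. G p \<in> B} \<in> sets ?M"
    using assms by (intro countable_in_sets_paths) (auto intro: countable_subset)
  moreover have "space ?M - A \<in> sets ?M"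
    using assms by (intro sets.compl_sets countable_in_sets_paths) auto
  ultimately show "(\<lambda>p. if p \<in> A then G p else 0) -` B \<inter> space ?M \<in> sets ?M"
    by auto
qed auto

lemma sets_chain_law[measurable_cong]: "sets (chain_law x0 K) = sets (paths UNIV)"
proof -
  interpret Ionescu_Tulcea "chain_kernel x0 K" "\<lambda>_. count_space UNIV"
    by (rule Ionescu_Tulcea_chain_kernel)
  show ?thesis
    unfolding chain_law_def by simp
qed

lemma nn_integral_chain_law_measurable:
  assumes "f \<in> borel_measurable (paths {0..<n})"
  shows "(\<integral>\<^sup>+\<omega>. f (restrict \<omega> {0..<n}) \<partial>chain_law x0 K) = (\<integral>\<^sup>+p. f p \<partial>path_pmf x0 K n)"
proof -
  interpret IT: Ionescu_Tulcea "chain_kernel x0 K" "\<lambda>_. count_space UNIV"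
    by (rule Ionescu_Tulcea_chain_kernel)
  have C: "(\<integral>\<^sup>+p. f p \<partial>IT.C 0 n (\<lambda>_. undefined)) = (\<integral>\<^sup>+p. f p \<partial>path_pmf x0 K n)"
    using assms
  proof (induction n arbitrary: f)
    case 0
    then show ?case
      by (simp add: nn_integral_return space_PiM)
  next
    case (Suc n)
    note [measurable] = Suc.prems
    have "(\<integral>\<^sup>+p. f p \<partial>IT.C 0 (Suc n) (\<lambda>_. undefined))
        = (\<integral>\<^sup>+p. \<integral>\<^sup>+x. f x \<partial>IT.eP n p \<partial>IT.C 0 n (\<lambda>_. undefined))"
      using Suc.prems
      by (simp, subst nn_integral_bind[where B="paths {0..<Suc n}"])
         (auto simp: measurable_cong_sets[OF IT.sets_C refl])
    also have "\<dots> = (\<integral>\<^sup>+p. \<integral>\<^sup>+x. f x \<partial>IT.eP n p \<partial>path_pmf x0 K n)"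
      by (rule Suc.IH) measurable
    also have "\<dots> = (\<integral>\<^sup>+p. \<integral>\<^sup>+x. f (p(n := x)) \<partial>chain_kernel x0 K n p \<partial>path_pmf x0 K n)"
      by (intro nn_integral_cong_AE AE_pmfI IT.nn_integral_eP path_pmf_in_space Suc.prems)
    also have "\<dots> = (\<integral>\<^sup>+p. f p \<partial>path_pmf x0 K (Suc n))"
      by (simp add: chain_kernel_def)
    finally show ?case .
  qed
  have "distr (chain_law x0 K) (paths {0..<n}) (\<lambda>\<omega>. restrict \<omega> {0..<n})
      = IT.CI {0..<n}"
    unfolding chain_law_def by (rule IT.distr_lim) simp
  also have "\<dots> = IT.C 0 n (\<lambda>_. undefined)"
  proof (rule measure_eqI)
    show "sets (IT.CI {0..<n}) = sets (IT.C 0 n (\<lambda>_. undefined))"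
      by (simp add: IT.CI_def IT.sets_C)
    fix X assume "X \<in> sets (IT.CI {0..<n})"
    then have X: "X \<in> sets (paths {0..<n})"
      by (simp add: IT.CI_def)
    then show "emeasure (IT.CI {0..<n}) X = emeasure (IT.C 0 n (\<lambda>_. undefined)) X"
      using sets.sets_into_space[OF X]
      by (subst IT.emeasure_CI[of _ n]) (auto simp: prod_emb_id space_PiM)
  qed
  finally have "(\<integral>\<^sup>+p. f p \<partial>distr (chain_law x0 K) (paths {0..<n}) (\<lambda>\<omega>. restrict \<omega> {0..<n}))
    = (\<integral>\<^sup>+p. f p \<partial>path_pmf x0 K n)"
    using C by simp
  then show ?thesis
    using assms by (subst (asm) nn_integral_distr) (auto intro!: measurable_restrict_subset)
qed

lemma AE_path_pmf: "AE \<omega> in chain_law x0 K. restrict \<omega> {0..<n} \<in> set_pmf (path_pmf x0 K n)"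
proof -
  let ?A = "set_pmf (path_pmf x0 K n)" and ?f = "\<lambda>p. indicator (- set_pmf (path_pmf x0 K n)) p :: ennreal"
  have A: "?A \<in> sets (paths {0..<n})"
    by (intro countable_in_sets_paths) (auto intro: path_pmf_in_space)
  have [measurable]: "?f \<in> borel_measurable (paths {0..<n})"
    using sets.compl_sets[OF A] by (simp add: borel_measurable_indicator_iff Diff_eq Int_commute)
  have [measurable]: "(\<lambda>\<omega>. restrict \<omega> {0..<n}) \<in> measurable (chain_law x0 K) (paths {0..<n})"
    by (simp add: measurable_cong_sets[OF sets_chain_law refl] measurable_restrict_subset)
  have "(\<integral>\<^sup>+\<omega>. ?f (restrict \<omega> {0..<n}) \<partial>chain_law x0 K) = (\<integral>\<^sup>+p. ?f p \<partial>path_pmf x0 K n)"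
    by (rule nn_integral_chain_law_measurable) measurable
  also have "\<dots> = 0"
    by (subst nn_integral_0_iff_AE) (auto intro!: AE_pmfI)
  finally have "AE \<omega> in chain_law x0 K. ?f (restrict \<omega> {0..<n}) = 0"
    by (subst (asm) nn_integral_0_iff_AE) measurable
  then show ?thesis
    by eventually_elim (simp add: indicator_def split: if_splits)
qed

text \<open>The function \<open>G\<close> is arbitrary: cut off outside the countable support of the law of the first
  \<open>n\<close> states, it becomes measurable without a change of either integral.\<close>

lemma nn_integral_chain_law:
  "(\<integral>\<^sup>+\<omega>. G (restrict \<omega> {0..<n}) \<partial>chain_law x0 K) = (\<integral>\<^sup>+p. G p \<partial>path_pmf x0 K n)"
proof -
  let ?H = "\<lambda>p. if p \<in> set_pmf (path_pmf x0 K n) then G p else 0"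
  have "(\<integral>\<^sup>+\<omega>. G (restrict \<omega> {0..<n}) \<partial>chain_law x0 K)
      = (\<integral>\<^sup>+\<omega>. ?H (restrict \<omega> {0..<n}) \<partial>chain_law x0 K)"
    using AE_path_pmf[where ?x0.0=x0 and K=K and n=n] by (intro nn_integral_cong_AE) auto
  also have "\<dots> = (\<integral>\<^sup>+p. ?H p \<partial>path_pmf x0 K n)"
    by (intro nn_integral_chain_law_measurable measurable_countable_support)
       (auto intro: path_pmf_in_space)
  also have "\<dots> = (\<integral>\<^sup>+p. G p \<partial>path_pmf x0 K n)"
    by (intro nn_integral_cong_AE AE_pmfI) auto
  finally show ?thesis .
qed

lemma path_pmf_SucE:
  assumes "p \<in> set_pmf (path_pmf x0 K (Suc (Suc n)))"
  obtains p' y where "p' \<in> set_pmf (path_pmf x0 K (Suc n))" "y \<in> set_pmf (K n (p' n))"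
    "p = p'(Suc n := y)"
  using assms by (subst (asm) path_pmf.simps(2)) (auto simp del: path_pmf.simps)

lemma prob_space_chain_law: "prob_space (chain_law x0 K)"
proof
  show "emeasure (chain_law x0 K) (space (chain_law x0 K)) = 1"
    using nn_integral_chain_law[where G="\<lambda>_. 1" and n=0] by simp
qed

lemma AE_chain_law:
  "AE \<omega> in chain_law x0 K. \<omega> 0 = x0 \<and> (\<forall>h. \<omega> (Suc h) \<in> set_pmf (K h (\<omega> h)))"
proof -
  have "AE \<omega> in chain_law x0 K. \<forall>n. restrict \<omega> {0..<n} \<in> set_pmf (path_pmf x0 K n)"
    by (simp add: AE_all_countable AE_path_pmf)
  then show ?thesis
  proof eventually_elim
    case (elim \<omega>)
    have "restrict \<omega> {0..<Suc 0} 0 = x0"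
      using elim[rule_format, of "Suc 0"] by auto
    moreover have "restrict \<omega> {0..<Suc (Suc h)} (Suc h) \<in> set_pmf (K h (restrict \<omega> {0..<Suc (Suc h)} h))" for h
      using elim[rule_format, of "Suc (Suc h)"]
      by (rule path_pmf_SucE) (simp del: path_pmf.simps)
    ultimately show ?case
      by simp
  qed
qed

lemma path_pmf_invariant:
  assumes "I x0" "\<And>h x y. I x \<Longrightarrow> y \<in> set_pmf (K h x) \<Longrightarrow> I y"
    and "p \<in> set_pmf (path_pmf x0 K (Suc n))"
  shows "I (p n)"
  using assms(3)
proof (induction n arbitrary: p)
  case 0
  then show ?case using assms(1) by auto
next
  case (Suc n)
  from Suc.prems obtain p' y where p': "p' \<in> set_pmf (path_pmf x0 K (Suc n))"
    "y \<in> set_pmf (K n (p' n))" "p = p'(Suc n := y)"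
    by (rule path_pmf_SucE)
  then show ?case
    using assms(2)[OF Suc.IH[OF p'(1)] p'(2)] by simp
qed

section \<open>Lower semicontinuity in the transition probabilities\<close>

text \<open>If every step of \<open>K'\<close> is at least \<open>c h\<close> times the step of \<open>K\<close> from the states that \<open>K\<close> can reach, the
  factors multiply along paths. The state at time 0 is deterministic, so \<open>n + 1\<close> states cost \<open>n\<close>
  factors.\<close>

lemma path_pmf_domination:
  fixes c :: "nat \<Rightarrow> ennreal" and K K' :: "nat \<Rightarrow> 'a \<Rightarrow> 'a pmf"
  assumes inv: "I x0" "\<And>h x y. I x \<Longrightarrow> y \<in> set_pmf (K h x) \<Longrightarrow> I y"
    and dom: "\<And>h x G. I x \<Longrightarrow> c h * (\<integral>\<^sup>+y. G y \<partial>K h x) \<le> (\<integral>\<^sup>+y. G y \<partial>K' h x)"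
  shows "(\<Prod>h<n. c h) * (\<integral>\<^sup>+p. G p \<partial>path_pmf x0 K (Suc n)) \<le> (\<integral>\<^sup>+p. G p \<partial>path_pmf x0 K' (Suc n))"
proof (induction n arbitrary: G)
  case (Suc n)
  let ?g = "\<lambda>K p. \<integral>\<^sup>+y. G (p(Suc n := y)) \<partial>K n (p n)"
  have eq: "(\<integral>\<^sup>+p. G p \<partial>path_pmf x0 K (Suc (Suc n))) = (\<integral>\<^sup>+p. ?g K p \<partial>path_pmf x0 K (Suc n))" for K
    by (subst path_pmf.simps) (simp del: path_pmf.simps)
  have "(\<Prod>h<Suc n. c h) * (\<integral>\<^sup>+p. G p \<partial>path_pmf x0 K (Suc (Suc n)))
      = (\<Prod>h<n. c h) * (\<integral>\<^sup>+p. c n * ?g K p \<partial>path_pmf x0 K (Suc n))"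
    by (subst eq) (simp add: nn_integral_cmult mult_ac del: path_pmf.simps)
  also have "\<dots> \<le> (\<Prod>h<n. c h) * (\<integral>\<^sup>+p. ?g K' p \<partial>path_pmf x0 K (Suc n))"
    using path_pmf_invariant[where I=I and K=K, OF inv]
    by (intro mult_left_mono nn_integral_mono_AE AE_pmfI dom) (auto simp del: path_pmf.simps)
  also have "\<dots> \<le> (\<integral>\<^sup>+p. ?g K' p \<partial>path_pmf x0 K' (Suc n))"
    by (rule Suc.IH)
  finally show ?case
    by (simp only: eq)
qed simp

text \<open>One-sided domination of the steps with factors tending to 1 gives the lower half of weak
  convergence for functions that are lower semicontinuous for the topology in which two paths are close
  if they agree up to a late time. Only paths in the set \<open>W\<close>, which has full measure, matter.\<close>

lemma chain_law_lower_semicontinuous: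
  fixes K :: "'i \<Rightarrow> nat \<Rightarrow> 'a \<Rightarrow> 'a pmf" and c :: "'i \<Rightarrow> nat \<Rightarrow> ennreal"
    and \<Phi> :: "(nat \<Rightarrow> 'a) \<Rightarrow> ennreal"
  assumes inv: "I x0" "\<And>h x y. I x \<Longrightarrow> y \<in> set_pmf (K0 h x) \<Longrightarrow> I y"
    and dom: "\<forall>\<^sub>F i in F. \<forall>h x G. I x \<longrightarrow>
                c i h * (\<integral>\<^sup>+y. G y \<partial>K0 h x) \<le> (\<integral>\<^sup>+y. G y \<partial>K i h x)"
    and c: "\<And>h. ((\<lambda>i. c i h) \<longlongrightarrow> 1) F"
    and W0: "AE \<omega> in chain_law x0 K0. \<omega> \<in> W"
    and W: "\<And>i. AE \<omega> in chain_law x0 (K i). \<omega> \<in> W"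
    and lsc: "\<And>\<omega> a. \<omega> \<in> W \<Longrightarrow> a < \<Phi> \<omega> \<Longrightarrow>
                \<exists>n. \<forall>\<omega>'\<in>W. (\<forall>h<n. \<omega>' h = \<omega> h) \<longrightarrow> a < \<Phi> \<omega>'"
    and a: "a < (\<integral>\<^sup>+\<omega>. \<Phi> \<omega> \<partial>chain_law x0 K0)"
  shows "\<forall>\<^sub>F i in F. a < (\<integral>\<^sup>+\<omega>. \<Phi> \<omega> \<partial>chain_law x0 (K i))"
proof -
  \<comment> \<open>The best lower bound for \<open>\<Phi>\<close> that can be read off from the first \<open>n + 1\<close> states.\<close>
  define G where "G n p = (INF \<omega>\<in>{\<omega>\<in>W. restrict \<omega> {0..<Suc n} = p}. \<Phi> \<omega>)" for n p
  have G_le: "G n (restrict \<omega> {0..<Suc n}) \<le> \<Phi> \<omega>" if "\<omega> \<in> W" for n \<omega>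
    unfolding G_def using that by (intro INF_lower) auto
  have liminf: "\<Phi> \<omega> \<le> liminf (\<lambda>n. G n (restrict \<omega> {0..<Suc n}))" if \<omega>: "\<omega> \<in> W" for \<omega>
    unfolding le_Liminf_iff
  proof safe
    fix b assume "b < \<Phi> \<omega>"
    then obtain b' where b': "b < b'" "b' < \<Phi> \<omega>"
      using dense by blast
    then obtain n where n: "\<And>\<omega>'. \<omega>' \<in> W \<Longrightarrow> \<forall>h<n. \<omega>' h = \<omega> h \<Longrightarrow> b' < \<Phi> \<omega>'"
      using lsc[OF \<omega> b'(2)] by blast
    have "b' \<le> G m (restrict \<omega> {0..<Suc m})" if "m \<ge> n" for m
      unfolding G_def
    proof (rule INF_greatest)
      fix \<omega>' assume *: "\<omega>' \<in> {\<omega>'\<in>W. restrict \<omega>' {0..<Suc m} = restrict \<omega> {0..<Suc m}}"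
      have "\<omega>' h = \<omega> h" if "h < n" for h
      proof -
        have "restrict \<omega>' {0..<Suc m} = restrict \<omega> {0..<Suc m}"
          using * by simp
        from fun_cong[OF this, of h] show ?thesis
          using \<open>h < n\<close> \<open>m \<ge> n\<close> by simp
      qed
      with * n[of \<omega>'] show "b' \<le> \<Phi> \<omega>'"
        by (auto intro: less_imp_le)
    qed
    then show "\<forall>\<^sub>F m in sequentially. b < G m (restrict \<omega> {0..<Suc m})"
      using b'(1) unfolding eventually_sequentially by (meson less_le_trans)
  qed
  \<comment> \<open>\<open>G n\<close> need not be measurable; Fatou's lemma is applied to this almost surely equal version.\<close>
  define H where "H n p = (if p \<in> set_pmf (path_pmf x0 K0 (Suc n)) then G n p else 0)" for n p
  have meas: "(\<lambda>\<omega>. H n (restrict \<omega> {0..<Suc n})) \<in> borel_measurable (chain_law x0 K0)" for n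
  proof (rule measurable_compose[where f="\<lambda>\<omega>. restrict \<omega> {0..<Suc n}" and g="H n"])
    show "(\<lambda>\<omega>. restrict \<omega> {0..<Suc n}) \<in> measurable (chain_law x0 K0) (paths {0..<Suc n})"
      unfolding measurable_cong_sets[OF sets_chain_law refl]
      by (rule measurable_restrict_subset) simp
    show "H n \<in> borel_measurable (paths {0..<Suc n})"
      unfolding H_def
      by (intro measurable_countable_support) (auto intro: path_pmf_in_space simp del: path_pmf.simps)
  qed
  have int_H: "(\<integral>\<^sup>+\<omega>. H n (restrict \<omega> {0..<Suc n}) \<partial>chain_law x0 K0)
      = (\<integral>\<^sup>+p. G n p \<partial>path_pmf x0 K0 (Suc n))" for n
  proof -
    have "(\<integral>\<^sup>+\<omega>. H n (restrict \<omega> {0..<Suc n}) \<partial>chain_law x0 K0)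
        = (\<integral>\<^sup>+p. H n p \<partial>path_pmf x0 K0 (Suc n))"
      by (rule nn_integral_chain_law)
    also have "\<dots> = (\<integral>\<^sup>+p. G n p \<partial>path_pmf x0 K0 (Suc n))"
      by (intro nn_integral_cong_AE AE_pmfI) (simp add: H_def)
    finally show ?thesis .
  qed
  have "AE \<omega> in chain_law x0 K0. \<forall>n. restrict \<omega> {0..<Suc n} \<in> set_pmf (path_pmf x0 K0 (Suc n))"
    unfolding AE_all_countable by (intro allI AE_path_pmf)
  with W0 have "AE \<omega> in chain_law x0 K0. \<Phi> \<omega> \<le> liminf (\<lambda>n. H n (restrict \<omega> {0..<Suc n}))"
  proof eventually_elim
    case (elim \<omega>)
    then show ?case
      using liminf[of \<omega>] by (simp add: H_def del: path_pmf.simps)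
  qed
  then have "(\<integral>\<^sup>+\<omega>. \<Phi> \<omega> \<partial>chain_law x0 K0)
      \<le> (\<integral>\<^sup>+\<omega>. liminf (\<lambda>n. H n (restrict \<omega> {0..<Suc n})) \<partial>chain_law x0 K0)"
    by (rule nn_integral_mono_AE)
  also have "\<dots> \<le> liminf (\<lambda>n. \<integral>\<^sup>+\<omega>. H n (restrict \<omega> {0..<Suc n}) \<partial>chain_law x0 K0)"
    by (rule nn_integral_liminf[OF meas])
  also have "\<dots> = liminf (\<lambda>n. \<integral>\<^sup>+p. G n p \<partial>path_pmf x0 K0 (Suc n))"
    by (simp only: int_H)
  finally have "a < liminf (\<lambda>n. \<integral>\<^sup>+p. G n p \<partial>path_pmf x0 K0 (Suc n))"
    using a by (rule less_le_trans[rotated])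
  then have "\<forall>\<^sub>F n in sequentially. a < (\<integral>\<^sup>+p. G n p \<partial>path_pmf x0 K0 (Suc n))"
    using le_Liminf_iff[THEN iffD1, OF order_refl] by blast
  then obtain n where n: "a < (\<integral>\<^sup>+p. G n p \<partial>path_pmf x0 K0 (Suc n))" (is "a < ?b")
    unfolding eventually_sequentially by blast
  have "((\<lambda>i. \<Prod>h<n. c i h) \<longlongrightarrow> 1) F"
  proof (induction n)
    case (Suc n)
    then show ?case
      using tendsto_mult_ennreal[OF Suc c[of n]] by (simp add: mult_ac)
  qed simp
  then have "((\<lambda>i. (\<Prod>h<n. c i h) * ?b) \<longlongrightarrow> 1 * ?b) F"
    by (intro tendsto_mult_ennreal) auto
  then have "\<forall>\<^sub>F i in F. a < (\<Prod>h<n. c i h) * ?b"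
    using n by (intro order_tendstoD(1)) simp_all
  with dom show ?thesis
  proof eventually_elim
    case (elim i)
    have "a < (\<Prod>h<n. c i h) * ?b"
      by fact
    also have "\<dots> \<le> (\<integral>\<^sup>+p. G n p \<partial>path_pmf x0 (K i) (Suc n))"
      using elim(1) by (intro path_pmf_domination[where I=I and K=K0, OF inv]) auto
    also have "\<dots> = (\<integral>\<^sup>+\<omega>. G n (restrict \<omega> {0..<Suc n}) \<partial>chain_law x0 (K i))"
      by (rule nn_integral_chain_law[symmetric])
    also have "\<dots> \<le> (\<integral>\<^sup>+\<omega>. \<Phi> \<omega> \<partial>chain_law x0 (K i))"
      using W[of i] by (intro nn_integral_mono_AE) (rule eventually_mono[OF _ G_le])
    finally show ?case .
  qed
qed

section \<open>The tree as a function of its generations\<close>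

text \<open>The sequences of generations in which each level arises from the previous one by a reproduction
  rule. Under both chains almost every path is of this kind, and for these paths forgetting the types yields
  a genuine tree whose level \<open>h\<close> is the \<open>h\<close>-th generation.\<close>

definition genealogies :: "(nat \<Rightarrow> generation) set" where
  "genealogies = {\<omega>. fst (\<omega> 0) = {[]} \<and> (\<forall>h. \<exists>c. \<omega> (Suc h) = next_generation (fst (\<omega> h)) c)}"

definition vertices :: "(nat \<Rightarrow> generation) \<Rightarrow> word set" where
  "vertices \<omega> = (\<Union>h. fst (\<omega> h))"

lemma genealogies_step:
  assumes "\<omega> \<in> genealogies"
  obtains k where "\<And>u i. u @ [i] \<in> fst (\<omega> (Suc h)) \<longleftrightarrow> u \<in> fst (\<omega> h) \<and> 1 \<le> i \<and> i \<le> k u"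
    and "[] \<notin> fst (\<omega> (Suc h))"
proof -
  obtain c where "\<omega> (Suc h) = next_generation (fst (\<omega> h)) c"
    using assms by (auto simp: genealogies_def)
  then show thesis
    by (intro that[of "\<lambda>u. fst (c u)"]) (auto simp: next_generation_def)
qed

lemma genealogies_length:
  assumes "\<omega> \<in> genealogies" "u \<in> fst (\<omega> h)"
  shows "length u = h"
  using assms(2)
proof (induction h arbitrary: u)
  case 0
  then show ?case using assms(1) by (auto simp: genealogies_def)
next
  case (Suc h)
  with genealogies_step[OF assms(1), of h] show ?case
    by (cases u rule: rev_cases) auto
qed

lemma vertices_iff:
  "\<omega> \<in> genealogies \<Longrightarrow> u \<in> vertices \<omega> \<longleftrightarrow> u \<in> fst (\<omega> (length u))"
  using genealogies_length by (fastforce simp: vertices_def)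

lemma vertices_child_iff:
  assumes "\<omega> \<in> genealogies"
  obtains k where "\<And>i. u @ [i] \<in> vertices \<omega> \<longleftrightarrow> u \<in> vertices \<omega> \<and> 1 \<le> i \<and> i \<le> k"
proof -
  obtain k where "\<And>i. u @ [i] \<in> fst (\<omega> (Suc (length u)))
      \<longleftrightarrow> u \<in> fst (\<omega> (length u)) \<and> 1 \<le> i \<and> i \<le> k u"
    using genealogies_step[OF assms, of "length u"] by metis
  then show thesis
    by (intro that[of "k u"]) (simp add: vertices_iff[OF assms])
qed

lemma is_tree_vertices:
  assumes "\<omega> \<in> genealogies"
  shows "is_tree (vertices \<omega>)"
  unfolding is_tree_def
proof (intro conjI allI ballI impI subsetI)
  show "[] \<in> vertices \<omega>"
    using assms by (auto simp: vertices_def genealogies_def intro!: exI[of _ 0])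
  show "u \<in> words" if "u \<in> vertices \<omega>" for u
    using that
  proof (induction u rule: rev_induct)
    case (snoc i u)
    obtain k where "\<And>i. u @ [i] \<in> vertices \<omega> \<longleftrightarrow> u \<in> vertices \<omega> \<and> 1 \<le> i \<and> i \<le> k"
      using vertices_child_iff[OF assms, of u] by blast
    then show ?case
      using snoc by (auto simp: words_def)
  qed (simp add: words_def)
  show "u \<in> vertices \<omega>" if "u @ v \<in> vertices \<omega>" for u v
    using that
  proof (induction v rule: rev_induct)
    case (snoc i v)
    then show ?case
      using vertices_child_iff[OF assms, of "u @ v"] by (metis append_assoc)
  qed simp
  fix u assume "u \<in> vertices \<omega>"
  then show "\<exists>k::enat. \<forall>i\<ge>1. u @ [i] \<in> vertices \<omega> \<longleftrightarrow> enat i \<le> k"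
    using vertices_child_iff[OF assms, of u] by (metis enat_ord_simps(1))
qed

lemma Rep_forget_types:
  "Rep_otree (forget_types \<omega>) = (if is_tree (vertices \<omega>) then vertices \<omega> else {[]})"
  by (simp add: forget_types_def vertices_def Let_def Abs_otree_inverse is_tree_root)

text \<open>The word \<open>u\<close> and its children live on the levels \<open>|u|\<close> and \<open>|u| + 1\<close>, which are among the first
  \<open>|u| + 2\<close> generations.\<close>

lemma num_children_local:
  assumes "\<omega> \<in> genealogies" "\<omega>' \<in> genealogies"
    and "\<forall>h<n. \<omega>' h = \<omega> h" "Suc (length u) < n"
  shows "num_children (forget_types \<omega>') u = num_children (forget_types \<omega>) u"
proof -
  have "u \<in> vertices \<omega>' \<longleftrightarrow> u \<in> vertices \<omega>"
    and "\<And>i. u @ [i] \<in> vertices \<omega>' \<longleftrightarrow> u @ [i] \<in> vertices \<omega>"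
    using assms by (simp_all add: vertices_iff)
  then show ?thesis
    using assms by (simp add: num_children_def Rep_forget_types is_tree_vertices)
qed

text \<open>A basic open set of trees constrains the numbers of children of finitely many words, hence
  finitely many generations. This holds also at trees with vertices of infinite degree, since the value
  \<open>\<infinity>\<close> is determined by these generations as well.\<close>

lemma forget_types_continuous:
  assumes "open U" "\<omega> \<in> genealogies" "forget_types \<omega> \<in> U"
  shows "\<exists>n. \<forall>\<omega>'\<in>genealogies. (\<forall>h<n. \<omega>' h = \<omega> h) \<longrightarrow> forget_types \<omega>' \<in> U"
proof -
  obtain V where V: "open V" "U = num_children -` V"
    using assms(1) unfolding open_otree_def by blast
  then have "openin (product_topology (\<lambda>_. euclidean) UNIV) V"
    "num_children (forget_types \<omega>) \<in> V"
    using assms(3) by (auto simp: open_fun_def)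
  from product_topology_open_contains_basis[OF this]
  obtain X where X: "num_children (forget_types \<omega>) \<in> (\<Pi>\<^sub>E u\<in>UNIV. X u)"
    "finite {u. X u \<noteq> UNIV}" "(\<Pi>\<^sub>E u\<in>UNIV. X u) \<subseteq> V"
    by auto
  define n where "n = Suc (Suc (Max (insert 0 (length ` {u. X u \<noteq> UNIV}))))"
  have n: "Suc (length u) < n" if "X u \<noteq> UNIV" for u
    using that X(2) by (auto simp: n_def less_Suc_eq_le)
  have "forget_types \<omega>' \<in> U" if \<omega>': "\<omega>' \<in> genealogies" "\<forall>h<n. \<omega>' h = \<omega> h" for \<omega>'
  proof -
    have "num_children (forget_types \<omega>') u \<in> X u" for u
    proof (cases "X u = UNIV")
      case False
      then have "num_children (forget_types \<omega>') u = num_children (forget_types \<omega>) u"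
        by (intro num_children_local[OF assms(2) \<omega>'] n)
      then show ?thesis using X(1) by auto
    qed simp
    then show ?thesis
      using X(3) V(2) by auto
  qed
  then show ?thesis by blast
qed

lemma AE_genealogies:
  assumes "fst x0 = {[]}" "\<And>h x y. y \<in> set_pmf (K h x) \<Longrightarrow> \<exists>c. y = next_generation (fst x) c"
  shows "AE \<omega> in chain_law x0 K. \<omega> \<in> genealogies"
  using AE_chain_law[of x0 K]
proof eventually_elim
  case (elim \<omega>)
  have "\<exists>c. \<omega> (Suc h) = next_generation (fst (\<omega> h)) c" for h
    using elim assms(2)[of "\<omega> (Suc h)" h "\<omega> h"] by simp
  then show ?case
    using elim assms(1) by (simp add: genealogies_def)
qed

lemma kesten_step_next_generation:
  "y \<in> set_pmf (kesten_step \<eta> q x) \<Longrightarrow> \<exists>c. y = next_generation (fst x) c"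
  by (cases x) (auto simp: kesten_step_def)

lemma tau_step_next_generation:
  "y \<in> set_pmf (tau_step \<eta> q \<theta> h x) \<Longrightarrow> \<exists>c. y = next_generation (fst x) c"
  by (cases x) (auto simp: tau_step_def)

text \<open>The description of the number of children as a countable supremum exhibits it as a measurable
  function of the events that a given word belongs to the tree.\<close>

lemma num_children_Sup:
  "num_children t u = (if u \<in> Rep_otree t
     then (SUP i. if 1 \<le> i \<and> u @ [i] \<in> Rep_otree t then ereal (real i) else 0) else -1)"
proof (cases "u \<in> Rep_otree t")
  case True
  moreover have "is_tree (Rep_otree t)"
    using Rep_otree[of t] by simp
  ultimately obtain k :: enat where k: "\<forall>i\<ge>1. u @ [i] \<in> Rep_otree t \<longleftrightarrow> enat i \<le> k"
    unfolding is_tree_def by blast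
  have the: "(THE k. \<forall>i\<ge>1. u @ [i] \<in> Rep_otree t \<longleftrightarrow> enat i \<le> k) = k"
  proof (rule the_equality)
    fix k' :: enat assume k': "\<forall>i\<ge>1. u @ [i] \<in> Rep_otree t \<longleftrightarrow> enat i \<le> k'"
    have le: "enat i \<le> k' \<longleftrightarrow> enat i \<le> k" for i
      using k k' by (cases "i \<ge> 1") (auto simp: not_less_eq_eq zero_enat_def[symmetric])
    show "k' = k"
      using le[of "the_enat k"] le[of "the_enat k'"] le[of "Suc (the_enat k)"] le[of "Suc (the_enat k')"]
      by (cases k; cases k') auto
  qed (use k in auto)
  have "(SUP i. if 1 \<le> i \<and> u @ [i] \<in> Rep_otree t then ereal (real i) else 0)
      = (SUP i. if enat i \<le> k then ereal_of_enat (enat i) else 0)"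
    using k by (intro SUP_cong) (auto simp: not_less_eq_eq zero_ereal_def)
  also have "\<dots> = ereal_of_enat k"
  proof (cases k)
    case (enat n)
    then show ?thesis
      by (intro antisym SUP_least SUP_upper2[of n]) auto
  next
    case infinity
    then show ?thesis
      by (simp add: SUP_nat_Infty)
  qed
  finally show ?thesis
    unfolding num_children_def the using True by simp
qed (simp add: num_children_def)

lemma measurable_forget_types: "forget_types \<in> borel_measurable (chain_law x0 K)"
proof (rule borel_measurableI)
  let ?M = "chain_law x0 K"
  have [measurable]: "Measurable.pred ?M (\<lambda>\<omega>. u \<in> fst (\<omega> h))" for u h
  proof -
    have "(\<lambda>\<omega>. \<omega> h) \<in> measurable ?M (count_space UNIV)"
      unfolding measurable_cong_sets[OF sets_chain_law refl]
      by (rule measurable_component_singleton) simp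
    then show ?thesis
      by (rule measurable_compose[where g="\<lambda>x. u \<in> fst x"]) simp
  qed
  have [measurable]: "Measurable.pred ?M (\<lambda>\<omega>. u \<in> vertices \<omega>)" for u
    unfolding vertices_def UN_iff by measurable
  have [measurable]: "Measurable.pred ?M (\<lambda>\<omega>. is_tree (vertices \<omega>))"
    unfolding is_tree_def subset_iff Ball_def by measurable
  have [measurable]: "Measurable.pred ?M (\<lambda>\<omega>. u \<in> Rep_otree (forget_types \<omega>))" for u
    unfolding Rep_forget_types if_distrib[of "\<lambda>A. u \<in> A"] by measurable
  have "(\<lambda>\<omega>. num_children (forget_types \<omega>) u) \<in> borel_measurable ?M" for u
    unfolding num_children_Sup by measurable
  then have "(\<lambda>\<omega>. num_children (forget_types \<omega>)) \<in> borel_measurable ?M"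
    by (rule measurable_coordinatewise_then_product)
  note * = measurable_sets[OF this]
  fix U :: "otree set" assume "open U"
  then obtain V where "open V" "U = num_children -` V"
    unfolding open_otree_def by blast
  then show "forget_types -` U \<inter> space ?M \<in> sets ?M"
    using *[of V] by (simp add: vimage_def)
qed

section \<open>Comparison of the two reproduction mechanisms\<close>

lemma frakc_pos: "\<eta> < 1 \<Longrightarrow> q < 1 \<Longrightarrow> 0 < frakc \<eta> q"
  by (simp add: frakc_def kap_def)

text \<open>The weights are those of a differentiated geometric series with ratio \<open>frakc \<eta> q (1 - q) < 1\<close>, so they
  can be normalized. That the support avoids 0 makes the uniform choice of a child meaningful.\<close>

lemma set_size_biased_pmf_1:
  assumes "0 < \<eta>" "\<eta> < 1" "0 < q" "q < 1"
  shows "set_pmf (size_biased_pmf \<eta> q 1) \<subseteq> {1..}"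
proof -
  define w where "w = size_biased_weight \<eta> q 1"
  define r where "r = frakc \<eta> q * (1 - q)"
  have "frakc \<eta> q \<le> 1"
    by (simp add: frakc_def)
  then have "r \<le> 1 - q" "0 \<le> r"
    using frakc_pos[of \<eta> q] assms by (simp_all add: r_def mult_left_le_one_le)
  then have r: "0 \<le> r" "r < 1"
    using assms by auto
  have w_Suc: "w (Suc n) = \<eta> * q * (real (Suc n) * r ^ n)" for n
  proof -
    have "frakc \<eta> q powi (int (Suc n) - 1) = frakc \<eta> q ^ n"
      by simp
    then show ?thesis
      by (simp add: w_def size_biased_weight_def frakp_def offspring_def r_def power_mult_distrib
          del: of_nat_Suc)
  qed
  have w0: "w 0 = 0"
    by (simp add: w_def size_biased_weight_def)
  have w_nonneg: "0 \<le> w n" for n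
    using assms r w0 by (cases n) (simp_all add: w_Suc)
  define s where "s = \<eta> * q * (1 / (1 - r)\<^sup>2)"
  have "(\<lambda>n. real (Suc n) * r ^ n) sums (1 / (1 - r)\<^sup>2)"
    using geometric_deriv_sums[of r] r by simp
  then have "(\<lambda>n. w (Suc n)) sums s"
    unfolding w_Suc s_def by (rule sums_mult)
  then have sums: "w sums s"
    using w0 sums_Suc_iff[of w s] by simp
  have "s > 0"
    using assms r by (simp add: s_def)
  have "(\<lambda>n. w n / s) sums 1"
    using sums_divide[OF sums, of s] \<open>s > 0\<close> by simp
  then have "(\<integral>\<^sup>+n. ennreal (w n / s) \<partial>count_space UNIV) = 1"
    using w_nonneg \<open>s > 0\<close> by (subst nn_integral_count_space_nat, subst suminf_ennreal_eq) auto
  then have "pmf (size_biased_pmf \<eta> q 1) n = w n / s" for n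
    unfolding size_biased_pmf_def w_def[symmetric] sums_unique[OF sums, symmetric]
    using w_nonneg \<open>s > 0\<close> by (subst pmf_embed_pmf) auto
  then show ?thesis
    using w0 by (auto simp: set_pmf_eq not_less_eq_eq Suc_le_eq intro!: Nat.gr0I)
qed

text \<open>Without the positivity of its mean, the Poisson law would be an unspecified one.\<close>

lemma zeta_pos:
  assumes "0 < \<eta>" "\<eta> < 1" "0 < q" "q < 1"
  shows "0 < zeta \<eta> q h"
proof -
  have "0 < mu \<eta> q" "0 < kap \<eta> q"
    using assms by (simp_all add: mu_def kap_def)
  moreover have "mu \<eta> q < 1 \<longleftrightarrow> 1 < kap \<eta> q" "1 < mu \<eta> q \<longleftrightarrow> kap \<eta> q < 1"
    using assms by (auto simp: mu_def kap_def field_simps)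
  moreover have "1 < gam q"
    using assms by (simp add: gam_def field_simps)
  ultimately show ?thesis
    by (auto simp: zeta_def zero_less_power_int)
qed

lemma reproduction_s_1:
  assumes "0 < \<eta>" "\<eta> < 1" "0 < q" "q < 1"
  shows "reproduction_s \<eta> q 1 = kesten_reproduction_s \<eta> q"
proof -
  have "pmf_of_set {I. I \<subseteq> {1..n} \<and> card I = 1} = map_pmf (\<lambda>i. {i}) (pmf_of_set {1..n})"
    if "n \<ge> 1" for n :: nat
  proof -
    have "{I. I \<subseteq> {1..n} \<and> card I = 1} = (\<lambda>i. {i}) ` {1..n}"
      by (auto simp: card_1_singleton_iff)
    then show ?thesis
      using that by (simp add: map_pmf_of_set_inj)
  qed
  then show ?thesis
    unfolding reproduction_s_def kesten_reproduction_s_def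
    using set_size_biased_pmf_1[OF assms]
    by (intro bind_pmf_cong refl) (auto simp: bind_map_pmf)
qed

text \<open>With a single vertex of type s and no increment there is nothing left to choose: this vertex has
  one child of type s.\<close>

lemma configurations_singleton:
  "configurations {v} 1 = {\<lambda>u\<in>{v}. 1}"
proof -
  have "k = (\<lambda>u\<in>{v}. 1)" if "k \<in> configurations {v} 1" for k
    using that by (auto simp: configurations_def PiE_iff extensional_def fun_eq_iff)
  moreover have "(\<lambda>u\<in>{v}. 1) \<in> configurations {v} 1"
    by (auto simp: configurations_def)
  ultimately show ?thesis by blast
qed

text \<open>An invariant of the Kesten chain. The spine vertex has to belong to the generation,
  since otherwise it would not reproduce and the spine would end.\<close>

definition single_spine :: "generation \<Rightarrow> bool" where
  "single_spine x \<longleftrightarrow> finite (fst x) \<and> (\<exists>v\<in>fst x. snd x = {v})"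

lemma single_spine_kesten_step:
  assumes "0 < \<eta>" "\<eta> < 1" "0 < q" "q < 1"
    and "single_spine x" "y \<in> set_pmf (kesten_step \<eta> q x)"
  shows "single_spine y"
proof -
  obtain V v where x: "x = (V, {v})" "finite V" "v \<in> V"
    using assms(5) by (cases x) (auto simp: single_spine_def)
  obtain c where y: "y = next_generation V c"
    and c: "c \<in> set_pmf (Pi_pmf V (0, {})
              (\<lambda>u. if u \<in> {v} then kesten_reproduction_s \<eta> q else reproduction_e \<eta> q))"
    using assms(6) by (auto simp: kesten_step_def x)
  have c': "c u \<in> set_pmf (if u \<in> {v} then kesten_reproduction_s \<eta> q else reproduction_e \<eta> q)"
    if "u \<in> V" for u
    using c that unfolding set_Pi_pmf[OF x(2)] by (auto simp: PiE_dflt_def)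
  have e: "snd (c u) = {}" if "u \<in> V" "u \<noteq> v" for u
    using c'[OF that(1)] that by (auto simp: reproduction_e_def)
  have "c v \<in> set_pmf (kesten_reproduction_s \<eta> q)"
    using c'[OF x(3)] by simp
  then obtain n i where "n \<in> set_pmf (size_biased_pmf \<eta> q 1)" "i \<in> set_pmf (pmf_of_set {1..n})"
    and cv: "c v = (n, {i})"
    by (auto simp: kesten_reproduction_s_def)
  then have i: "i \<in> {1..n}"
    using set_size_biased_pmf_1[OF assms(1-4)] by (subst (asm) set_pmf_of_set) auto
  have "fst y = (\<Union>u\<in>V. (\<lambda>i. u @ [i]) ` {1..fst (c u)})"
    by (auto simp: y next_generation_def)
  then have "finite (fst y)"
    using x(2) by simp
  moreover have "v @ [i] \<in> fst y" "snd y = {v @ [i]}"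
    using x(3) i cv e by (force simp: y next_generation_def)+
  ultimately show ?thesis
    by (auto simp: single_spine_def)
qed

text \<open>The bound is the contribution of the increment \<open>\<Delta> = 0\<close>, whose Poisson probability is the
  prefactor.\<close>

lemma tau_step_dominates_kesten_step:
  assumes "0 < \<eta>" "\<eta> < 1" "0 < q" "q < 1" "0 < \<theta>"
    and "single_spine x"
  shows "ennreal (exp (- (\<theta> * zeta \<eta> q h))) * (\<integral>\<^sup>+y. G y \<partial>kesten_step \<eta> q x)
           \<le> (\<integral>\<^sup>+y. G y \<partial>tau_step \<eta> q \<theta> h x)"
proof -
  obtain V v where x: "x = (V, {v})" "finite V" "v \<in> V"
    using assms(6) by (cases x) (auto simp: single_spine_def)
  \<comment> \<open>\<open>R k\<close> is the joint reproduction law given the configuration \<open>k\<close>, and \<open>H \<Delta>\<close> is the conditional expectation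
    given the increment.\<close>
  define R where "R k = Pi_pmf V (0, {})
      (\<lambda>u. if u \<in> {v} then reproduction_s \<eta> q (k u) else reproduction_e \<eta> q)" for k :: "word \<Rightarrow> nat"
  define H where "H \<Delta> = (\<integral>\<^sup>+k. \<integral>\<^sup>+c. G (next_generation V c) \<partial>R k
      \<partial>pmf_of_set (configurations {v} (card {v} + \<Delta>)))" for \<Delta> :: nat
  have rate: "0 < \<theta> * zeta \<eta> q h"
    using zeta_pos[OF assms(1-4)] assms(5) by simp
  have "R (\<lambda>u\<in>{v}. 1) = Pi_pmf V (0, {})
      (\<lambda>u. if u \<in> {v} then kesten_reproduction_s \<eta> q else reproduction_e \<eta> q)"
    unfolding R_def using reproduction_s_1[OF assms(1-4)]
    by (intro arg_cong[where f="Pi_pmf V (0, {})"] ext) simp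
  then have "(\<integral>\<^sup>+y. G y \<partial>kesten_step \<eta> q x) = H 0"
    using configurations_singleton[of v]
    by (simp add: kesten_step_def x H_def pmf_of_set_singleton)
  then have "ennreal (exp (- (\<theta> * zeta \<eta> q h))) * (\<integral>\<^sup>+y. G y \<partial>kesten_step \<eta> q x)
      = (\<integral>\<^sup>+\<Delta>. H \<Delta> * indicator {0} \<Delta> \<partial>poisson_pmf (\<theta> * zeta \<eta> q h))"
    using rate by (simp add: emeasure_pmf_single mult.commute)
  also have "\<dots> \<le> (\<integral>\<^sup>+\<Delta>. H \<Delta> \<partial>poisson_pmf (\<theta> * zeta \<eta> q h))"
    by (intro nn_integral_mono) (auto simp: indicator_def)
  also have "\<dots> = (\<integral>\<^sup>+y. G y \<partial>tau_step \<eta> q \<theta> h x)"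
    by (simp add: tau_step_def x H_def R_def)
  finally show ?thesis .
qed

section \<open>Weak convergence\<close>

lemma prob_space_tau_law: "prob_space (tau_law \<eta> q \<theta>)"
  unfolding tau_law_def
  by (intro prob_space.prob_space_distr prob_space_chain_law measurable_forget_types)

lemma prob_space_kesten_law: "prob_space (kesten_law \<eta> q)"
  unfolding kesten_law_def
  by (intro prob_space.prob_space_distr prob_space_chain_law measurable_forget_types)

lemma eventually_less_nn_integral_tau_law:
  fixes g :: "otree \<Rightarrow> ennreal"
  assumes "0 < \<eta>" "\<eta> < 1" "0 < q" "q < 1"
    and cont: "continuous_on UNIV g"
    and a: "a < (\<integral>\<^sup>+t. g t \<partial>kesten_law \<eta> q)"
  shows "\<forall>\<^sub>F \<theta> in at_right 0. a < (\<integral>\<^sup>+t. g t \<partial>tau_law \<eta> q \<theta>)"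
proof -
  have [measurable]: "g \<in> borel_measurable borel"
    by (rule borel_measurable_continuous_onI[OF cont])
  have distr: "(\<integral>\<^sup>+t. g t \<partial>distr (chain_law x0 K) borel forget_types)
      = (\<integral>\<^sup>+\<omega>. g (forget_types \<omega>) \<partial>chain_law x0 K)" for x0 K
    by (intro nn_integral_distr measurable_forget_types) measurable
  show ?thesis
    using a unfolding tau_law_def kesten_law_def distr
  proof (rule chain_law_lower_semicontinuous[rotated -1])
    show "single_spine ({[]}, {[]})"
      by (simp add: single_spine_def)
    show "single_spine y" if "single_spine x" "y \<in> set_pmf (kesten_step \<eta> q x)" for x y
      by (rule single_spine_kesten_step[OF assms(1-4) that])
    show "\<forall>\<^sub>F \<theta> in at_right 0. \<forall>h x G. single_spine x \<longrightarrow>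
        ennreal (exp (- (\<theta> * zeta \<eta> q h))) * (\<integral>\<^sup>+y. G y \<partial>kesten_step \<eta> q x)
          \<le> (\<integral>\<^sup>+y. G y \<partial>tau_step \<eta> q \<theta> h x)"
      using eventually_at_right_less[of "0::real"]
      by eventually_elim (use tau_step_dominates_kesten_step[OF assms(1-4)] in blast)
    show "((\<lambda>\<theta>. ennreal (exp (- (\<theta> * zeta \<eta> q h)))) \<longlongrightarrow> 1) (at_right 0)" for h
    proof -
      have "((\<lambda>\<theta>. ennreal (exp (- (\<theta> * zeta \<eta> q h)))) \<longlongrightarrow> ennreal (exp (- (0 * zeta \<eta> q h)))) (at_right 0)"
        by (intro tendsto_ennrealI tendsto_intros)
      then show ?thesis by simp
    qed
    show "AE \<omega> in chain_law ({[]}, {[]}) (\<lambda>_. kesten_step \<eta> q). \<omega> \<in> genealogies"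
      by (rule AE_genealogies) (auto dest: kesten_step_next_generation)
    show "AE \<omega> in chain_law ({[]}, {[]}) (tau_step \<eta> q \<theta>). \<omega> \<in> genealogies" for \<theta>
      by (rule AE_genealogies) (auto dest: tau_step_next_generation)
    show "\<exists>n. \<forall>\<omega>'\<in>genealogies. (\<forall>h<n. \<omega>' h = \<omega> h) \<longrightarrow> b < g (forget_types \<omega>')"
      if "\<omega> \<in> genealogies" "b < g (forget_types \<omega>)" for \<omega> b
    proof -
      have "open (g -` {b<..})"
        using cont by (intro open_vimage) auto
      from forget_types_continuous[OF this that(1)] that(2) show ?thesis
        by simp
    qed
  qed
qed

text \<open>Adding a bound of \<open>\<bar>f\<bar>\<close> makes the integrand nonnegative and shifts all integrals by the same
  constant, because all laws are probability measures.\<close>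

lemma eventually_less_integral_tau_law:
  fixes f :: "otree \<Rightarrow> real"
  assumes "0 < \<eta>" "\<eta> < 1" "0 < q" "q < 1"
    and cont: "continuous_on UNIV f" and bounded: "bounded (range f)"
    and a: "a < integral\<^sup>L (kesten_law \<eta> q) f"
  shows "\<forall>\<^sub>F \<theta> in at_right 0. a < integral\<^sup>L (tau_law \<eta> q \<theta>) f"
proof -
  obtain B where B: "\<And>t. \<bar>f t\<bar> \<le> B"
    using bounded by (auto simp: bounded_iff)
  have "0 \<le> f t + B" for t
    using B[of t] by simp
  have nn: "(\<integral>\<^sup>+t. ennreal (f t + B) \<partial>M) = ennreal (integral\<^sup>L M f + B)" "0 \<le> integral\<^sup>L M f + B"
    if "prob_space M" "sets M = sets borel" for M
  proof -
    interpret prob_space M by fact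
    have [measurable]: "f \<in> borel_measurable M"
      using borel_measurable_continuous_onI[OF cont] by (simp add: measurable_cong_sets[OF that(2) refl])
    have int: "integrable M f"
      by (rule integrable_const_bound[where B=B]) (auto simp: B)
    then have eq: "(\<integral>t. f t + B \<partial>M) = integral\<^sup>L M f + B"
      by (simp add: prob_space)
    show "0 \<le> integral\<^sup>L M f + B"
      unfolding eq[symmetric] using \<open>\<And>t. 0 \<le> f t + B\<close> by (intro integral_nonneg_AE) auto
    show "(\<integral>\<^sup>+t. ennreal (f t + B) \<partial>M) = ennreal (integral\<^sup>L M f + B)"
      unfolding eq[symmetric] using \<open>\<And>t. 0 \<le> f t + B\<close> int
      by (intro nn_integral_eq_integral) auto
  qed
  have sets: "sets (kesten_law \<eta> q) = sets borel" "sets (tau_law \<eta> q \<theta>) = sets borel" for \<theta>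
    by (simp_all add: kesten_law_def tau_law_def)
  show ?thesis
  proof (cases "a + B < 0")
    case True
    have "a < integral\<^sup>L (tau_law \<eta> q \<theta>) f" for \<theta>
      using True nn(2)[OF prob_space_tau_law sets(2), of \<theta>] by linarith
    then show ?thesis by simp
  next
    case False
    have "continuous_on UNIV (\<lambda>t. ennreal (f t + B))"
      by (intro continuous_on_ennreal continuous_intros cont)
    moreover have "ennreal (a + B) < (\<integral>\<^sup>+t. ennreal (f t + B) \<partial>kesten_law \<eta> q)"
      using a False by (subst nn(1)[OF prob_space_kesten_law sets(1)]) (simp add: ennreal_less_iff)
    ultimately have "\<forall>\<^sub>F \<theta> in at_right 0. ennreal (a + B) < (\<integral>\<^sup>+t. ennreal (f t + B) \<partial>tau_law \<eta> q \<theta>)"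
      by (rule eventually_less_nn_integral_tau_law[OF assms(1-4)])
    then show ?thesis
      using False by (simp add: nn(1)[OF prob_space_tau_law sets(2)] ennreal_less_iff)
  qed
qed

theorem mainTheorem5:
  fixes \<eta> q :: real
  assumes "0 < \<eta>" "\<eta> < 1" "0 < q" "q < 1"
  shows "weakly_converges (\<lambda>\<theta>. tau_law \<eta> q \<theta>) (kesten_law \<eta> q) (at_right 0)"
  unfolding weakly_converges_def
proof (intro allI impI)
  fix f :: "otree \<Rightarrow> real"
  assume f: "continuous_on UNIV f" "bounded (range f)"
  then have f': "continuous_on UNIV (\<lambda>t. - f t)" "bounded (range (\<lambda>t. - f t))"
    by (auto intro: continuous_intros simp: bounded_iff)
  show "((\<lambda>\<theta>. integral\<^sup>L (tau_law \<eta> q \<theta>) f) \<longlongrightarrow> integral\<^sup>L (kesten_law \<eta> q) f) (at_right 0)"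
  proof (rule order_tendstoI)
    fix a assume "a < integral\<^sup>L (kesten_law \<eta> q) f"
    then show "\<forall>\<^sub>F \<theta> in at_right 0. a < integral\<^sup>L (tau_law \<eta> q \<theta>) f"
      by (rule eventually_less_integral_tau_law[OF assms f])
  next
    fix a assume "integral\<^sup>L (kesten_law \<eta> q) f < a"
    then have "- a < integral\<^sup>L (kesten_law \<eta> q) (\<lambda>t. - f t)"
      by simp
    from eventually_less_integral_tau_law[OF assms f' this]
    show "\<forall>\<^sub>F \<theta> in at_right 0. integral\<^sup>L (tau_law \<eta> q \<theta>) f < a"
      by simp
  qed
qed

end
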